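(* For $\lambda$-almost every $[a_1,a_2,\ldots]\in[0,1]$, $$\limsup_{n\to\infty}\frac{\log\Big(a_{n+1}\big/\sum_{i=1}^{n}a_i\Big)}{\log\log\Big(\sum_{i=1}^{n}a_i\Big)}\leq 0,$$ where $\lambda$ denotes Lebesgue measure on $[0,1]$.
   Context: For positive integers $a_1,a_2,\ldots$, $[a_1,a_2,\ldots]:=\cfrac{1}{a_1+\cfrac{1}{a_2+\cdots}}$ denotes the regular continued fraction with these entries; Lebesgue-almost every $x\in[0,1]$ (every irrational) has a unique such infinite expansion. *)

theory Defs
  imports "HOL-Analysis.Analysis"
begin

fun finite_cf :: "nat list \<Rightarrow> real" where
  "finite_cf [] = 0"
| "finite_cf (b # bs) = 1 / (real b + finite_cf bs)"

text \<open>
  \<open>has_cf_expansion x a\<close> means \<open>x = [a\<^sub>1, a\<^sub>2, \<dots>]\<close>: the value of an infinite continued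
  fraction is the limit of its finite truncations \<open>[a\<^sub>1, \<dots>, a\<^sub>n]\<close>. The entries are
  indexed from 1; the value \<open>a 0\<close> plays no role.
\<close>

definition has_cf_expansion :: "real \<Rightarrow> (nat \<Rightarrow> nat) \<Rightarrow> bool" where
  "has_cf_expansion x a \<longleftrightarrow>
     (\<forall>i\<ge>1. a i > 0) \<and> (\<lambda>n. finite_cf (map a [1..<Suc n])) \<longlonglongrightarrow> x"

end

theory Submission
  imports Defs
begin

text \<open>
  Write \<open>a\<^sub>1, a\<^sub>2, \<dots>\<close> for the digits of a random point and \<open>S\<^sub>n\<close> for the sum of the first
  \<open>n\<close> of them. The digits are not independent, but nearly so: given the first \<open>n\<close> digits, the
  next one is at least \<open>m\<close> with probability between \<open>1 / m\<close> and \<open>2 / m\<close>. The reason is that a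
  cylinder is the image of the unit interval under a Moebius map with bounded distortion
  (\<open>cylinder_measure_bounds\<close>). Two consequences give the theorem.

  The upper bound \<open>2 / m\<close> and the convergence of \<open>\<Sum>n. 1 / (n (ln n)\<^sup>p)\<close> for \<open>p > 1\<close> show that
  almost surely \<open>a\<^sub>n\<^sub>+\<^sub>1 \<le> n (ln n)\<^sup>p\<close> for all large \<open>n\<close>, up to a shift in the logarithm
  (\<open>AE_digit_le\<close>).

  The lower bound \<open>1 / m\<close> shows that a digit truncated at \<open>M\<close> has conditional mean at least the
  harmonic number \<open>harm M\<close>. An exponential-moment argument with \<open>M\<close> about \<open>sqrt n\<close> then
  makes \<open>S\<^sub>n \<le> n ln n / 8\<close> so unlikely that almost surely \<open>S\<^sub>n \<ge> n ln n / 8\<close> for all large \<open>n\<close>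
  (\<open>AE_digit_sum_ge\<close>).

  Taking \<open>p = 1 + \<epsilon>\<close> and dividing, \<open>a\<^sub>n\<^sub>+\<^sub>1 / S\<^sub>n\<close> is at most a constant times
  \<open>(ln n)\<^sup>\<epsilon>\<close>, and \<open>n \<le> S\<^sub>n\<close>; so the upper limit is at most \<open>2 \<epsilon>\<close> for every \<open>\<epsilon>\<close> in a
  sequence tending to \<open>0\<close>.
\<close>


section \<open>Continued fraction digits\<close>

definition unit_irrationals :: "real set" where
  "unit_irrationals = {0<..<1} - \<rat>"

definition gauss_map :: "real \<Rightarrow> real" where
  "gauss_map x = frac (1 / x)"

text \<open>
  Positions count from \<open>0\<close>, so that \<open>digit n x\<close> is the partial quotient usually written
  \<open>a\<^sub>n\<^sub>+\<^sub>1\<close>; it is read off from the \<open>n\<close>-th iterate of the Gauss map.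
\<close>

definition digit :: "nat \<Rightarrow> real \<Rightarrow> nat" where
  "digit n x = nat \<lfloor>1 / (gauss_map ^^ n) x\<rfloor>"

definition digits :: "nat \<Rightarrow> real \<Rightarrow> nat list" where
  "digits n x = map (\<lambda>i. digit i x) [0..<n]"

lemma inverse_rational_iff: "1 / (x::real) \<in> \<rat> \<longleftrightarrow> x \<in> \<rat>"
  by (metis Rats_divide Rats_1 div_by_1 divide_divide_eq_right mult.left_neutral)

lemma gauss_map_unit_irrationals:
  assumes "x \<in> unit_irrationals"
  shows "gauss_map x \<in> unit_irrationals"
proof -
  have nr: "1 / x \<notin> \<rat>"
    using assms by (simp add: inverse_rational_iff unit_irrationals_def)
  have "gauss_map x \<notin> \<rat>"
  proof
    assume "gauss_map x \<in> \<rat>"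
    then have "gauss_map x + of_int \<lfloor>1 / x\<rfloor> \<in> \<rat>"
      by (intro Rats_add) auto
    with nr show False by (simp add: gauss_map_def frac_def)
  qed
  moreover from this have "gauss_map x \<noteq> 0" by auto
  ultimately show ?thesis
    using frac_ge_0[of "1/x"] frac_lt_1[of "1/x"]
    by (auto simp: unit_irrationals_def gauss_map_def)
qed

lemma gauss_map_pow_unit_irrationals:
  "x \<in> unit_irrationals \<Longrightarrow> (gauss_map ^^ n) x \<in> unit_irrationals"
  by (induction n) (auto intro: gauss_map_unit_irrationals)

lemma digit_ge_iff:
  assumes "x \<in> unit_irrationals" "m > 0"
  shows "m \<le> digit n x \<longleftrightarrow> (gauss_map ^^ n) x \<le> 1 / real m"
proof -
  have "(gauss_map ^^ n) x > 0"
    using gauss_map_pow_unit_irrationals[OF assms(1), of n] by (simp add: unit_irrationals_def)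
  moreover have "m \<le> digit n x \<longleftrightarrow> real m \<le> 1 / (gauss_map ^^ n) x"
    using assms(2) le_floor_iff[of "int m" "1 / (gauss_map ^^ n) x"] unfolding digit_def by linarith
  ultimately show ?thesis
    using assms(2) by (simp add: field_simps)
qed

lemma digit_pos:
  assumes "x \<in> unit_irrationals"
  shows "digit n x \<ge> 1"
  using digit_ge_iff[OF assms, of 1 n] gauss_map_pow_unit_irrationals[OF assms, of n]
  by (simp add: unit_irrationals_def)

lemma length_digits [simp]: "length (digits n x) = n"
  by (simp add: digits_def)

lemma digits_Suc: "digits (Suc n) x = digits n x @ [digit n x]"
  by (simp add: digits_def)

lemma digits_Suc_shift: "digits (Suc n) x = digit 0 x # digits n (gauss_map x)"
  unfolding digits_def
  by (simp add: upt_conv_Cons map_Suc_upt[symmetric] digit_def funpow_swap1 del: upt_Suc)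

section \<open>Cylinder maps\<close>

text \<open>
  For positive digits, the inverse branches of the iterated Gauss map: \<open>cf_with_tail [b\<^sub>1, \<dots>, b\<^sub>n]\<close> maps
  \<open>(0, 1)\<close> onto the points whose first digits are \<open>b\<^sub>1, \<dots>, b\<^sub>n\<close>, up to rational points, and
  its argument is the tail of the expansion. The tail \<open>0\<close> gives the finite continued fraction.
\<close>

fun cf_with_tail :: "nat list \<Rightarrow> real \<Rightarrow> real" where
  "cf_with_tail [] t = t"
| "cf_with_tail (b # bs) t = 1 / (real b + cf_with_tail bs t)"

lemma finite_cf_conv_tail: "finite_cf bs = cf_with_tail bs 0"
  by (induction bs) auto

lemma cf_with_tail_snoc:
  "cf_with_tail (bs @ [b]) t = cf_with_tail bs (1 / (real b + t))"
  by (induction bs) auto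

lemma cf_with_tail_digits:
  assumes "x \<in> unit_irrationals"
  shows "cf_with_tail (digits n x) ((gauss_map ^^ n) x) = x"
  using assms
proof (induction n arbitrary: x)
  case 0
  then show ?case by (simp add: digits_def)
next
  case (Suc n)
  have "real (digit 0 x) + gauss_map x = 1 / x"
    using Suc.prems by (auto simp: digit_def gauss_map_def frac_def unit_irrationals_def)
  then show ?case
    using Suc.IH[OF gauss_map_unit_irrationals[OF Suc.prems]]
    by (simp add: digits_Suc_shift funpow_swap1)
qed

lemma digits_cf_with_tail:
  assumes "\<forall>b \<in> set bs. b \<ge> 1" "t \<in> unit_irrationals"
  shows "cf_with_tail bs t \<in> unit_irrationals \<and> digits (length bs) (cf_with_tail bs t) = bs
    \<and> (gauss_map ^^ length bs) (cf_with_tail bs t) = t"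
  using assms(1)
proof (induction bs)
  case Nil
  then show ?case using assms(2) by (simp add: digits_def)
next
  case (Cons b bs)
  define y where "y = cf_with_tail bs t"
  have y: "y \<in> unit_irrationals" and IH: "digits (length bs) y = bs"
    "(gauss_map ^^ length bs) y = t"
    using Cons by (auto simp: y_def)
  have b: "b \<ge> 1" using Cons.prems by auto
  have yb: "0 < y" "y < 1" "y \<notin> \<rat>" using y by (auto simp: unit_irrationals_def)
  have fl: "\<lfloor>real b + y\<rfloor> = int b" using yb by linarith
  have "real b + y \<notin> \<rat>"
  proof
    assume "real b + y \<in> \<rat>"
    then have "(real b + y) - real b \<in> \<rat>" by (intro Rats_diff) auto
    with yb show False by simp
  qed
  then have "1 / (real b + y) \<in> unit_irrationals"
    using yb b by (auto simp: unit_irrationals_def inverse_rational_iff field_simps)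
  moreover have "digit 0 (1 / (real b + y)) = b"
    by (simp add: digit_def fl)
  moreover have g: "gauss_map (1 / (real b + y)) = y"
    by (simp add: gauss_map_def frac_def fl)
  ultimately show ?case
    using IH by (simp add: y_def[symmetric] digits_Suc_shift funpow_swap1)
qed

text \<open>
  Appending a digit \<open>b\<close> substitutes \<open>1 / (b + t)\<close> for \<open>t\<close>, which turns the coefficients
  \<open>(A, B, C, D)\<close> into \<open>(A b + B, A, C b + D, C)\<close>. This changes only the sign of the determinant.
  The classical names for \<open>C\<close> and \<open>D\<close> are \<open>q\<^sub>n\<close> and \<open>q\<^sub>n\<^sub>-\<^sub>1\<close>. The inequality
  \<open>D \<le> C\<close> yields the bounded distortion on which all probability estimates rest, while
  \<open>length bs \<le> C\<close> makes cylinders shrink; the bound on \<open>C + D\<close> carries the latter through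
  the induction, because the next \<open>C\<close> is at least \<open>C + D\<close>.
\<close>

lemma cf_with_tail_moebius:
  assumes "\<forall>b \<in> set bs. b \<ge> 1"
  shows "\<exists>A B C D. (\<forall>t\<in>{0..1}. cf_with_tail bs t = (A + B * t) / (C + D * t))
    \<and> \<bar>B * C - A * D\<bar> = 1 \<and> 0 \<le> D \<and> D \<le> C \<and> 1 \<le> C \<and> real (length bs) \<le> C
    \<and> real (length bs) + 1 \<le> C + D"
  using assms
proof (induction bs rule: rev_induct)
  case Nil
  show ?case by (rule exI[of _ 0], rule exI[of _ 1], rule exI[of _ 1], rule exI[of _ 0]) auto
next
  case (snoc b bs)
  then obtain A B C D where
    f: "\<And>t. t \<in> {0..1} \<Longrightarrow> cf_with_tail bs t = (A + B * t) / (C + D * t)"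
    and det: "\<bar>B * C - A * D\<bar> = 1" and D: "0 \<le> D" "D \<le> C" and C: "1 \<le> C"
      "real (length bs) \<le> C" and CD: "real (length bs) + 1 \<le> C + D"
    by auto
  have b: "real b \<ge> 1" using snoc.prems by simp
  have Cb: "C \<le> C * real b" using C b by (simp add: mult_le_cancel_left1)
  have "cf_with_tail (bs @ [b]) t = (A * b + B + A * t) / (C * b + D + C * t)"
    if t: "t \<in> {0..1}" for t
  proof -
    have "1 / (real b + t) \<in> {0..1}" using t b by (auto simp: field_simps)
    from f[OF this]
    have "cf_with_tail (bs @ [b]) t = (A + B * (1 / (real b + t))) / (C + D * (1 / (real b + t)))"
      by (simp only: cf_with_tail_snoc)
    also have "\<dots> = ((A + B * (1 / (real b + t))) * (real b + t)) /
        ((C + D * (1 / (real b + t))) * (real b + t))"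
      using t b by simp
    also have "\<dots> = (A * b + B + A * t) / (C * b + D + C * t)"
    proof -
      have "z * (1 / (real b + t)) * (real b + t) = z" for z
        using t b by simp
      then show ?thesis by (simp only: distrib_right) (simp add: algebra_simps)
    qed
    finally show ?thesis .
  qed
  note map' = this
  have "A * (C * b + D) - (A * b + B) * C = - (B * C - A * D)"
    by (simp add: algebra_simps)
  then have det': "\<bar>A * (C * b + D) - (A * b + B) * C\<bar> = 1" using det by (simp only: abs_minus_cancel)
  have len: "real (length (bs @ [b])) = real (length bs) + 1" by simp
  have "0 \<le> C" "C \<le> C * b + D" "1 \<le> C * b + D" "real (length (bs @ [b])) \<le> C * b + D"
    "real (length (bs @ [b])) + 1 \<le> C * b + D + C"
    using D C CD Cb len by - linarith+
  with map' det' show ?case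
    by blast
qed

text \<open>
  The point and its \<open>n\<close>-th convergent are the images of \<open>(gauss_map ^^ n) x\<close> and of \<open>0\<close>
  under the same Moebius map of determinant \<open>1\<close> or \<open>-1\<close>, so their distance is
  \<open>t / (C (C + D t)) \<le> 1 / n\<close>.
\<close>

lemma has_cf_expansion_digits:
  assumes "x \<in> unit_irrationals"
  shows "has_cf_expansion x (\<lambda>i. digit (i - 1) x)"
  unfolding has_cf_expansion_def
proof
  show "\<forall>i\<ge>1. 0 < digit (i - 1) x"
    using digit_pos[OF assms] by (auto simp: Suc_le_eq)
  have map: "map (\<lambda>i. digit (i - 1) x) [1..<Suc n] = digits n x" for n
    by (auto simp: digits_def intro!: nth_equalityI simp del: upt_Suc)
  have bound: "\<bar>finite_cf (digits n x) - x\<bar> \<le> 1 / real n" if n: "n > 0" for n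
  proof -
    define t where "t = (gauss_map ^^ n) x"
    have t: "0 < t" "t < 1"
      using gauss_map_pow_unit_irrationals[OF assms, of n]
      by (auto simp: t_def unit_irrationals_def)
    have "\<forall>b\<in>set (digits n x). b \<ge> 1"
      using digit_pos[OF assms] by (auto simp: digits_def)
    from cf_with_tail_moebius[OF this] obtain A B C D where
      f: "\<And>t. t \<in> {0..1} \<Longrightarrow> cf_with_tail (digits n x) t = (A + B * t) / (C + D * t)"
      and det: "\<bar>B * C - A * D\<bar> = 1" and D: "0 \<le> D" and C: "1 \<le> C" "real n \<le> C"
      by auto
    have pos: "C + D * t \<ge> C" using D t by simp
    have "x - finite_cf (digits n x) = (A + B * t) / (C + D * t) - A / C"
      using f[of t] f[of 0] t cf_with_tail_digits[OF assms, of n]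
      by (simp add: finite_cf_conv_tail t_def)
    also have "\<dots> = (B * C - A * D) * t / ((C + D * t) * C)"
      using C pos by (simp add: field_simps)
    finally have "\<bar>x - finite_cf (digits n x)\<bar> = t / ((C + D * t) * C)"
      using det t C pos by (simp add: abs_mult)
    also have "\<dots> \<le> 1 / (real n * 1)"
      using t C pos n by (intro frac_le mult_mono) auto
    finally show ?thesis by (simp add: abs_minus_commute)
  qed
  have "(\<lambda>n. finite_cf (digits n x) - x) \<longlonglongrightarrow> 0"
    by (rule Lim_null_comparison[OF _ lim_1_over_n])
       (use bound in \<open>auto intro!: eventually_sequentiallyI[of 1]\<close>)
  then show "(\<lambda>n. finite_cf (map (\<lambda>i. digit (i - 1) x) [1..<Suc n])) \<longlonglongrightarrow> x"
    unfolding map by (simp add: LIM_zero_iff)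
qed

section \<open>Measurability and the length of cylinders\<close>

lemma measurable_gauss_map [measurable]: "gauss_map \<in> borel_measurable borel"
  unfolding gauss_map_def frac_def by measurable

lemma measurable_gauss_map_pow [measurable]: "(gauss_map ^^ n) \<in> borel_measurable borel"
  by (induction n) (auto simp: comp_def intro: measurable_compose[OF _ measurable_gauss_map])

lemma measurable_digit [measurable]: "digit n \<in> measurable borel (count_space UNIV)"
  unfolding digit_def by measurable

lemma sets_unit_irrationals [measurable]: "unit_irrationals \<in> sets borel"
  unfolding unit_irrationals_def
  by (rule sets.Diff) (auto intro: sets.countable[OF _ countable_rat])

lemma measurable_digits [measurable]: "digits n \<in> measurable borel (count_space UNIV)"
proof (induction n)
  case 0
  then show ?case by (simp add: digits_def)
next
  case (Suc n)
  have "(\<lambda>x. (digits n x, digit n x)) \<in> measurable borel (count_space UNIV \<Otimes>\<^sub>M count_space UNIV)"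
    using Suc by (intro measurable_Pair) auto
  then have "(\<lambda>x. (digits n x, digit n x)) \<in> measurable borel (count_space UNIV)"
    by (simp add: pair_measure_countable)
  then have "(\<lambda>x. (\<lambda>(bs, b). bs @ [b]) (digits n x, digit n x)) \<in> measurable borel (count_space UNIV)"
    by (rule measurable_compose) auto
  then show ?case by (simp add: digits_Suc)
qed

text \<open>
  The threshold \<open>m\<close> restricts the digit that follows the prefix \<open>bs\<close>. All digits are positive,
  so \<open>m = 0\<close> and \<open>m = 1\<close> both give the full cylinder of \<open>bs\<close>.
\<close>

definition cylinder :: "nat list \<Rightarrow> nat \<Rightarrow> real set" where
  "cylinder bs m = {x \<in> unit_irrationals. digits (length bs) x = bs \<and> m \<le> digit (length bs) x}"

lemma sets_cylinder [measurable]: "cylinder bs m \<in> sets borel"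
  unfolding cylinder_def by measurable

lemma emeasure_subset_unit_irrationals_le_1:
  assumes "S \<subseteq> unit_irrationals"
  shows "emeasure lborel S \<le> 1"
proof -
  have "emeasure lborel S \<le> emeasure lborel {0..1::real}"
    using assms by (intro emeasure_mono) (auto simp: unit_irrationals_def)
  then show ?thesis by simp
qed

lemma emeasure_cylinder: "emeasure lborel (cylinder bs m) = ennreal (measure lborel (cylinder bs m))"
proof -
  have "emeasure lborel (cylinder bs m) \<le> 1"
    by (rule emeasure_subset_unit_irrationals_le_1) (auto simp: cylinder_def)
  then show ?thesis
    by (intro emeasure_eq_ennreal_measure) (auto simp: top_unique)
qed

lemma cylinder_empty:
  assumes "\<not> (\<forall>b\<in>set bs. b \<ge> 1)"
  shows "cylinder bs m = {}"
proof -
  have False if "x \<in> unit_irrationals" "digits (length bs) x = bs" for x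
  proof -
    have "set bs = (\<lambda>i. digit i x) ` {0..<length bs}"
      by (subst that(2)[symmetric]) (simp add: digits_def)
    with assms digit_pos[OF that(1)] show False by auto
  qed
  then show ?thesis by (auto simp: cylinder_def)
qed

lemma cylinder_conv_image:
  assumes "\<forall>b\<in>set bs. b \<ge> 1" "m > 0"
  shows "cylinder bs m = cf_with_tail bs ` {t \<in> unit_irrationals. t \<le> 1 / real m}" (is "?L = ?R")
proof
  show "?L \<subseteq> ?R"
  proof
    fix x assume x: "x \<in> ?L"
    let ?t = "(gauss_map ^^ length bs) x"
    from x have "x \<in> unit_irrationals" "digits (length bs) x = bs" "m \<le> digit (length bs) x"
      by (auto simp: cylinder_def)
    then have "x = cf_with_tail bs ?t" "?t \<in> unit_irrationals" "?t \<le> 1 / real m"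
      using cf_with_tail_digits[of x "length bs"] gauss_map_pow_unit_irrationals[of x]
        digit_ge_iff[of x m] assms(2) by auto
    then show "x \<in> ?R" by blast
  qed
  show "?R \<subseteq> ?L"
    using digits_cf_with_tail[OF assms(1)] digit_ge_iff[OF _ assms(2)]
    by (auto simp: cylinder_def)
qed

text \<open>
  A Moebius map without pole in \<open>[0, 1]\<close> is monotone there, so the image of \<open>[0, 1 / m]\<close> is the
  interval between the images of the end points. The cylinder is this interval without the
  countably many images of rational numbers, hence has the same length
  \<open>(1 / m) / (C (C + D / m))\<close>.
\<close>

lemma measure_cylinder_moebius:
  assumes bs: "\<forall>b\<in>set bs. b \<ge> 1" and m: "m > 0"
    and f: "\<And>t. t \<in> {0..1} \<Longrightarrow> cf_with_tail bs t = (A + B * t) / (C + D * t)"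
    and det: "\<bar>B * C - A * D\<bar> = 1" and D: "0 \<le> D" and C: "1 \<le> C"
  shows "emeasure lborel (cylinder bs m) = ennreal (1 / (C * (C * real m + D)))"
proof -
  let ?\<phi> = "\<lambda>t. (A + B * t) / (C + D * t)"
  define s where "s = 1 / real m"
  have s: "0 < s" "s \<le> 1" "s \<in> \<rat>" using m by (auto simp: s_def)
  have pos: "C + D * t > 0" if "t \<ge> 0" for t
    using C mult_nonneg_nonneg[OF D that] by linarith
  have diff: "?\<phi> t - ?\<phi> u = (B * C - A * D) * (t - u) / ((C + D * t) * (C + D * u))"
    if "t \<ge> 0" "u \<ge> 0" for t u
    using pos[OF that(1)] pos[OF that(2)] by (simp add: field_simps)
  have inj: "inj_on ?\<phi> {0..s}"
  proof
    fix t u assume tu: "t \<in> {0..s}" "u \<in> {0..s}" "?\<phi> t = ?\<phi> u"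
    then have "(B * C - A * D) * (t - u) / ((C + D * t) * (C + D * u)) = 0"
      using diff[of t u] by simp
    then show "t = u" using pos[of t] pos[of u] tu det by auto
  qed
  have cont: "continuous_on {0..s} ?\<phi>"
    using pos by (intro continuous_intros) (auto simp: less_imp_neq[symmetric])
  have mono: "min (?\<phi> 0) (?\<phi> s) \<le> ?\<phi> t \<and> ?\<phi> t \<le> max (?\<phi> 0) (?\<phi> s)" if t: "t \<in> {0..s}" for t
  proof -
    have "B * C - A * D = 1 \<or> B * C - A * D = -1" using det by linarith
    then show ?thesis
    proof
      assume e: "B * C - A * D = 1"
      have "0 \<le> ?\<phi> t - ?\<phi> 0" "0 \<le> ?\<phi> s - ?\<phi> t"
        using t s pos[of t] pos[of s] pos[of 0]
        by (subst diff; force simp: e intro!: divide_nonneg_nonneg mult_nonneg_nonneg)+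
      then show ?thesis by linarith
    next
      assume e: "B * C - A * D = -1"
      have "0 \<le> ?\<phi> 0 - ?\<phi> t" "0 \<le> ?\<phi> t - ?\<phi> s"
        using t s pos[of t] pos[of s] pos[of 0]
        by (subst diff; force simp: e intro!: divide_nonneg_nonneg mult_nonneg_nonneg)+
      then show ?thesis by linarith
    qed
  qed
  have "connected (?\<phi> ` {0..s})"
    by (intro connected_continuous_image cont) simp
  moreover have "?\<phi> 0 \<in> ?\<phi> ` {0..s}" "?\<phi> s \<in> ?\<phi> ` {0..s}"
    by (rule imageI, use s in simp)+
  then have "min (?\<phi> 0) (?\<phi> s) \<in> ?\<phi> ` {0..s}" "max (?\<phi> 0) (?\<phi> s) \<in> ?\<phi> ` {0..s}"
    by (auto simp only: min_def max_def split: if_split)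
  ultimately have "{min (?\<phi> 0) (?\<phi> s)..max (?\<phi> 0) (?\<phi> s)} \<subseteq> ?\<phi> ` {0..s}"
    using connected_contains_Icc by blast
  with mono have img: "?\<phi> ` {0..s} = {min (?\<phi> 0) (?\<phi> s)..max (?\<phi> 0) (?\<phi> s)}"
    by fastforce
  \<comment> \<open>The end point \<open>s\<close> is rational, so it and \<open>0\<close> and \<open>1\<close> drop out together with \<open>\<rat>\<close>.\<close>
  have U: "{t \<in> unit_irrationals. t \<le> s} = {0..s} - (\<rat> \<inter> {0..s})"
    using s by (auto simp: unit_irrationals_def le_less)
  have "cylinder bs m = ?\<phi> ` {t \<in> unit_irrationals. t \<le> s}"
    unfolding cylinder_conv_image[OF bs m] s_def[symmetric]
    by (intro image_cong refl f) (auto simp: unit_irrationals_def)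
  also have "\<dots> = ?\<phi> ` {0..s} - ?\<phi> ` (\<rat> \<inter> {0..s})"
    unfolding U by (intro inj_on_image_set_diff[OF inj]) auto
  finally have eq: "cylinder bs m = ?\<phi> ` {0..s} - ?\<phi> ` (\<rat> \<inter> {0..s})" .
  have "countable (?\<phi> ` (\<rat> \<inter> {0..s}))"
    by (intro countable_image countable_Int1 countable_rat)
  then have "?\<phi> ` (\<rat> \<inter> {0..s}) \<in> null_sets lborel"
    by (rule countable_imp_null_set_lborel)
  then have "emeasure lborel (cylinder bs m) = emeasure lborel (?\<phi> ` {0..s})"
    unfolding eq by (rule emeasure_Diff_null_set) (simp add: img)
  also have "\<dots> = ennreal \<bar>?\<phi> s - ?\<phi> 0\<bar>"
    unfolding img by (simp add: min_def max_def abs_if)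
  also have "\<bar>?\<phi> s - ?\<phi> 0\<bar> = 1 / (C * (C * real m + D))"
  proof -
    have "\<bar>?\<phi> s - ?\<phi> 0\<bar> = s / ((C + D * s) * C)"
      using s pos[of s] C det diff[of s 0] by (simp add: abs_mult)
    also have "\<dots> = 1 / (C * (C * real m + D))"
      using m C D unfolding s_def by (simp add: field_simps)
    finally show ?thesis .
  qed
  finally show ?thesis .
qed

text \<open>
  Bounded distortion: given any prefix, the next digit is at least \<open>m\<close> with conditional probability
  between \<open>1 / m\<close> and \<open>2 / m\<close>. Indeed this probability is \<open>(C + D) / (C m + D)\<close> with
  \<open>0 \<le> D \<le> C\<close>. A prefix that contains the digit \<open>0\<close> gives an empty cylinder and satisfies both
  bounds trivially.
\<close>

lemma cylinder_measure_bounds: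
  assumes "m > 0"
  shows "measure lborel (cylinder bs 0) / real m \<le> measure lborel (cylinder bs m)"
    and "measure lborel (cylinder bs m) \<le> 2 / real m * measure lborel (cylinder bs 0)"
proof -
  have c0: "cylinder bs 0 = cylinder bs 1"
    using digit_pos by (auto simp: cylinder_def)
  have "measure lborel (cylinder bs 0) / real m \<le> measure lborel (cylinder bs m) \<and>
    measure lborel (cylinder bs m) \<le> 2 / real m * measure lborel (cylinder bs 0)"
  proof (cases "\<forall>b\<in>set bs. b \<ge> 1")
    case False
    then show ?thesis by (simp add: cylinder_empty)
  next
    case True
    from cf_with_tail_moebius[OF True] obtain A B C D where
      f: "\<And>t. t \<in> {0..1} \<Longrightarrow> cf_with_tail bs t = (A + B * t) / (C + D * t)"
      and det: "\<bar>B * C - A * D\<bar> = 1" and D: "0 \<le> D" "D \<le> C" and C: "1 \<le> C"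
      by auto
    have e: "emeasure lborel (cylinder bs k) = ennreal (1 / (C * (C * real k + D)))"
      if "k > 0" for k
      using measure_cylinder_moebius[OF True that f det D(1) C] by simp
    have pos: "C * real k + D \<ge> 0" for k using C D by simp
    have me: "measure lborel (cylinder bs k) = 1 / (C * (C * real k + D))" if "k > 0" for k
      using e[OF that] pos[of k] C unfolding measure_def by (subst e[OF that]) auto
    have l: "C * real m + D \<le> (C + D) * real m"
      using assms D by (simp add: distrib_right mult_le_cancel_left1)
    have r: "(C + D) * real m \<le> 2 * (C * real m + D)"
      using D mult_right_mono[OF D(2), of "real m"] by (simp only: distrib_right distrib_left) linarith
    have p: "C * real m > 0" "C > 0" "C + D > 0" "C * real m + D > 0" using assms C D 
      by (auto intro: add_pos_nonneg)
    have "1 / (C * (C + D)) / real m \<le> 1 / (C * (C * real m + D))"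
      unfolding divide_divide_eq_left
      using p l assms by (intro divide_left_mono) (auto simp: mult.assoc)
    moreover have "1 / (C * (C * real m + D)) \<le> 2 / real m * (1 / (C * (C + D)))"
    proof -
      have "C * (C + D) * real m \<le> 2 * (C * (C * real m + D))"
        using mult_left_mono[OF r, of C] p by (simp add: algebra_simps)
      then show ?thesis using p assms by (simp add: divide_simps mult_ac)
    qed
    ultimately show ?thesis
      unfolding c0 using me[OF assms] me[of 1] e[OF assms] by simp
  qed
  then show "measure lborel (cylinder bs 0) / real m \<le> measure lborel (cylinder bs m)"
    and "measure lborel (cylinder bs m) \<le> 2 / real m * measure lborel (cylinder bs 0)"
    by auto
qed


section \<open>Averaging over cylinders\<close>

text \<open>
  For each fixed length there are countably many cylinders, and they partition the irrationals.
\<close>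

lemma nn_integral_cylinders:
  fixes H :: "real \<Rightarrow> ennreal"
  assumes [measurable]: "H \<in> borel_measurable borel"
  shows "(\<integral>\<^sup>+x. H x * indicator unit_irrationals x \<partial>lborel) =
    (\<integral>\<^sup>+bs. (\<integral>\<^sup>+x. H x * indicator (cylinder bs 0) x \<partial>lborel) \<partial>count_space {bs. length bs = n})"
proof -
  have "H x * indicator unit_irrationals x =
      (\<integral>\<^sup>+bs. H x * indicator (cylinder bs 0) x \<partial>count_space {bs. length bs = n})" for x
  proof -
    have "(\<integral>\<^sup>+bs. H x * indicator (cylinder bs 0) x \<partial>count_space {bs. length bs = n}) =
        (\<Sum>bs\<in>{digits n x}. H x * indicator (cylinder bs 0) x)"
      by (rule nn_integral_count_space') (auto simp: cylinder_def)
    then show ?thesis by (simp add: cylinder_def indicator_def)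
  qed
  then have "(\<integral>\<^sup>+x. H x * indicator unit_irrationals x \<partial>lborel) =
      (\<integral>\<^sup>+x. (\<integral>\<^sup>+bs. H x * indicator (cylinder bs 0) x \<partial>count_space {bs. length bs = n}) \<partial>lborel)"
    by (simp only:)
  also have "\<dots> = (\<integral>\<^sup>+bs. (\<integral>\<^sup>+x. H x * indicator (cylinder bs 0) x \<partial>lborel) \<partial>count_space {bs. length bs = n})"
    by (rule nn_integral_count_space_nn_integral) auto
  finally show ?thesis .
qed

text \<open>
  This replaces conditioning on the first \<open>n\<close> digits: a bound for the average of \<open>G\<close> that holds
  on every cylinder of length \<open>n\<close> can be pulled out of an integral with a factor that depends
  on these digits only.
\<close>

lemma nn_integral_digits_le:
  fixes f :: "nat list \<Rightarrow> ennreal" and G :: "real \<Rightarrow> ennreal"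
  assumes [measurable]: "G \<in> borel_measurable borel"
    and G: "\<And>bs. length bs = n \<Longrightarrow> (\<integral>\<^sup>+x. G x * indicator (cylinder bs 0) x \<partial>lborel)
      \<le> c * emeasure lborel (cylinder bs 0)"
  shows "(\<integral>\<^sup>+x. f (digits n x) * G x * indicator unit_irrationals x \<partial>lborel)
    \<le> c * (\<integral>\<^sup>+x. f (digits n x) * indicator unit_irrationals x \<partial>lborel)"
proof -
  have [measurable]: "(\<lambda>x. f (digits n x)) \<in> borel_measurable borel"
    by (rule measurable_compose[OF measurable_digits]) simp
  have out: "(\<integral>\<^sup>+x. f (digits n x) * R x * indicator (cylinder bs 0) x \<partial>lborel) =
      f bs * (\<integral>\<^sup>+x. R x * indicator (cylinder bs 0) x \<partial>lborel)"
    if [simp]: "length bs = n" and [measurable]: "R \<in> borel_measurable borel" for bs R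
    by (subst nn_integral_cmult[symmetric])
       (auto intro!: nn_integral_cong simp: cylinder_def mult.assoc split: split_indicator)
  have "(\<integral>\<^sup>+x. f (digits n x) * G x * indicator unit_irrationals x \<partial>lborel) =
    (\<integral>\<^sup>+bs. f bs * (\<integral>\<^sup>+x. G x * indicator (cylinder bs 0) x \<partial>lborel) \<partial>count_space {bs. length bs = n})"
    by (subst nn_integral_cylinders[of _ n]) (auto intro!: nn_integral_cong simp: out)
  also have "\<dots> \<le> (\<integral>\<^sup>+bs. c * (f bs * emeasure lborel (cylinder bs 0)) \<partial>count_space {bs. length bs = n})"
    by (intro nn_integral_mono) (auto simp: mult.left_commute[of c] intro!: mult_left_mono G)
  also have "\<dots> = c * (\<integral>\<^sup>+bs. f bs * emeasure lborel (cylinder bs 0) \<partial>count_space {bs. length bs = n})"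
    by (rule nn_integral_cmult) simp
  also have "(\<integral>\<^sup>+bs. f bs * emeasure lborel (cylinder bs 0) \<partial>count_space {bs. length bs = n}) =
      (\<integral>\<^sup>+x. f (digits n x) * indicator unit_irrationals x \<partial>lborel)"
    using out[of _ "\<lambda>_. 1"]
    by (subst nn_integral_cylinders[of _ n]) (auto intro!: nn_integral_cong)
  finally show ?thesis .
qed

section \<open>Tails of single digits\<close>

text \<open>
  Here the prefix is averaged out with the constant factor \<open>1\<close>, so the bound does not depend on \<open>n\<close>.
\<close>

lemma emeasure_digit_ge:
  assumes "m > 0"
  shows "emeasure lborel {x \<in> unit_irrationals. m \<le> digit n x} \<le> ennreal (2 / real m)"
proof -
  let ?G = "indicator {x. m \<le> digit n x} :: real \<Rightarrow> ennreal"
  have "(\<integral>\<^sup>+x. ?G x * indicator (cylinder bs 0) x \<partial>lborel)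
      \<le> ennreal (2 / real m) * emeasure lborel (cylinder bs 0)" if "length bs = n" for bs
  proof -
    have "(\<integral>\<^sup>+x. ?G x * indicator (cylinder bs 0) x \<partial>lborel) =
        (\<integral>\<^sup>+x. indicator (cylinder bs m) x \<partial>lborel)"
      using that by (intro nn_integral_cong) (auto simp: cylinder_def split: split_indicator)
    also have "\<dots> = ennreal (measure lborel (cylinder bs m))"
      by (simp add: emeasure_cylinder)
    also have "\<dots> \<le> ennreal (2 / real m * measure lborel (cylinder bs 0))"
      by (intro ennreal_leI cylinder_measure_bounds assms)
    also have "\<dots> = ennreal (2 / real m) * emeasure lborel (cylinder bs 0)"
      by (subst ennreal_mult) (auto simp: emeasure_cylinder)
    finally show ?thesis .
  qed
  then have "(\<integral>\<^sup>+x. 1 * ?G x * indicator unit_irrationals x \<partial>lborel)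
      \<le> ennreal (2 / real m) * (\<integral>\<^sup>+x. 1 * indicator unit_irrationals x \<partial>lborel)"
    by (intro nn_integral_digits_le[where f = "\<lambda>_. 1"]) auto
  also have "\<dots> \<le> ennreal (2 / real m) * 1"
    using emeasure_subset_unit_irrationals_le_1[of unit_irrationals] by (intro mult_left_mono) auto
  finally have "(\<integral>\<^sup>+x. ?G x * indicator unit_irrationals x \<partial>lborel) \<le> ennreal (2 / real m)"
    by simp
  also have "(\<integral>\<^sup>+x. ?G x * indicator unit_irrationals x \<partial>lborel) =
      (\<integral>\<^sup>+x. indicator {x \<in> unit_irrationals. m \<le> digit n x} x \<partial>lborel)"
    by (intro nn_integral_cong) (auto split: split_indicator)
  finally show ?thesis by simp
qed

text \<open>
  By Cauchy condensation the series behaves like \<open>\<Sum>n. n powr - p\<close>. Shifting the argument of the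
  logarithm by one keeps the terms monotone from \<open>n = 1\<close> on, where \<open>ln n\<close> would vanish and
  division by zero would give the value \<open>0\<close>.
\<close>

lemma summable_Bertrand:
  fixes p :: real
  assumes "p > 1"
  shows "summable (\<lambda>n. 1 / (real n * ln (real n + 1) powr p))" (is "summable ?f")
proof -
  have pos: "ln (real n + 1) powr p > 0" if "n > 0" for n :: nat
    using that by (simp add: ln_gt_zero)
  have "summable ?f \<longleftrightarrow> summable (\<lambda>n. 2 ^ n * ?f (2 ^ n))"
  proof (rule condensation_test)
    fix m :: nat assume m: "0 < m"
    have "real m * ln (real m + 1) powr p \<le> real (Suc m) * ln (real (Suc m) + 1) powr p"
      using m assms by (intro mult_mono powr_mono2) auto
    then show "?f (Suc m) \<le> ?f m"
      using pos[OF m] m by (intro divide_left_mono mult_pos_pos pos) auto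
  qed simp
  moreover have "summable (\<lambda>n. 2 ^ n * ?f (2 ^ n))"
  proof (rule summable_comparison_test_ev)
    show "summable (\<lambda>n. ln 2 powr - p * real n powr - p)"
      using assms by (intro summable_mult) (simp add: summable_real_powr_iff)
    show "\<forall>\<^sub>F n in sequentially. norm (2 ^ n * ?f (2 ^ n)) \<le> ln 2 powr - p * real n powr - p"
    proof (rule eventually_sequentiallyI[of 1])
      fix n :: nat assume n: "1 \<le> n"
      have "ln 2 * real n = ln (2 ^ n)" by (simp add: ln_realpow)
      also have "\<dots> \<le> ln (2 ^ n + 1)"
        by (subst ln_le_cancel_iff) (auto intro: add_pos_pos)
      finally have "ln (2 ^ n + 1) powr - p \<le> (ln 2 * real n) powr - p"
        using assms n by (intro powr_mono2') auto
      then show "norm (2 ^ n * ?f (2 ^ n)) \<le> ln 2 powr - p * real n powr - p"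
        using n by (simp add: powr_mult powr_minus field_simps)
    qed
  qed
  ultimately show ?thesis by blast
qed

text \<open>
  Borel--Cantelli with the tail bound \<open>2 / m\<close>. The exponent \<open>p > 1\<close> is what makes the
  exceptional probabilities summable.
\<close>

lemma AE_digit_le:
  fixes p :: real
  assumes "p > 1"
  shows "AE x in lborel. x \<in> unit_irrationals \<longrightarrow>
    (\<forall>\<^sub>F n in sequentially. real (digit n x) \<le> real n * ln (real n + 1) powr p)"
proof -
  define T where "T n = real n * ln (real n + 1) powr p" for n
  define A where "A n = {x \<in> unit_irrationals. T n < real (digit n x)}" for n
  have [measurable]: "A n \<in> sets borel" for n
    unfolding A_def by measurable
  have fin: "emeasure lborel (A n) < \<infinity>" for n
    using emeasure_subset_unit_irrationals_le_1[of "A n"]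
    by (auto simp: A_def less_top[symmetric] top_unique)
  have bound: "measure lborel (A n) \<le> 2 * (1 / T n)" if n: "n > 0" for n
  proof -
    have T: "T n > 0" using n unfolding T_def by (simp add: ln_gt_zero)
    define m where "m = nat \<lceil>T n\<rceil>"
    have m: "m > 0" "T n \<le> real m" using T by (auto simp: m_def real_nat_ceiling_ge)
    have "A n \<subseteq> {x \<in> unit_irrationals. m \<le> digit n x}"
      unfolding A_def m_def by (auto simp: nat_le_iff ceiling_le_iff)
    then have "emeasure lborel (A n) \<le> emeasure lborel {x \<in> unit_irrationals. m \<le> digit n x}"
      by (rule emeasure_mono) simp
    also have "\<dots> \<le> ennreal (2 / real m)" by (rule emeasure_digit_ge[OF m(1)])
    also have "\<dots> \<le> ennreal (2 / T n)" using m T by (intro ennreal_leI divide_left_mono) auto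
    finally show ?thesis
      using T fin[of n] by (simp add: emeasure_eq_ennreal_measure ennreal_le_iff less_top)
  qed
  have "summable (\<lambda>n. measure lborel (A n))"
  proof (rule summable_comparison_test_ev)
    show "summable (\<lambda>n. 2 * (1 / T n))"
      unfolding T_def by (intro summable_mult summable_Bertrand assms)
    show "\<forall>\<^sub>F n in sequentially. norm (measure lborel (A n)) \<le> 2 * (1 / T n)"
      using bound by (intro eventually_sequentiallyI[of 1]) auto
  qed
  then have "AE x in lborel. \<forall>\<^sub>F n in sequentially. x \<in> space lborel - A n"
    by (intro borel_cantelli_AE1 fin) auto
  then show ?thesis
  proof (rule AE_mp, intro AE_I2 impI)
    fix x assume "\<forall>\<^sub>F n in sequentially. x \<in> space lborel - A n" and x: "x \<in> unit_irrationals"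
    then show "\<forall>\<^sub>F n in sequentially. real (digit n x) \<le> real n * ln (real n + 1) powr p"
      by (elim eventually_mono) (auto simp: A_def T_def not_less)
  qed
qed

section \<open>Growth of digit sums\<close>

text \<open>
  With \<open>u = min b M / M \<in> [0, 1]\<close> this is \<open>1 - u / 2\<close>. It serves as a replacement for the Laplace
  weight \<open>exp (- b / M)\<close>: it dominates it, but is affine in the truncated digit, so its mean needs
  nothing but the probabilities of the events \<open>b \<ge> m\<close> for \<open>m \<le> M\<close>.
\<close>

definition truncation_weight :: "nat \<Rightarrow> nat \<Rightarrow> real" where
  "truncation_weight M b = 1 - real (min b M) / (2 * real M)"

lemma truncation_weight_bounds:
  assumes "M > 0"
  shows "1 / 2 \<le> truncation_weight M b" "exp (- (real b / real M)) \<le> truncation_weight M b"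
proof -
  define u where "u = real (min b M) / real M"
  have u: "0 \<le> u" "u \<le> 1" "u \<le> real b / real M"
    using assms by (auto simp: u_def divide_simps)
  have w: "truncation_weight M b = 1 - u / 2"
    by (simp add: truncation_weight_def u_def)
  show "1 / 2 \<le> truncation_weight M b" using u unfolding w by simp
  have "(1 - u / 2) * exp u \<ge> (1 - u / 2) * (1 + u)"
    using u by (intro mult_left_mono exp_ge_add_one_self) auto
  moreover have "(1 - u / 2) * (1 + u) = 1 + u * (1 - u) / 2"
    by (simp add: field_simps)
  ultimately have "1 \<le> (1 - u / 2) * exp u"
    using u mult_nonneg_nonneg[of u "1 - u"] by linarith
  then have "exp (- u) \<le> 1 - u / 2"
    by (simp add: exp_minus field_simps)
  moreover have "exp (- (real b / real M)) \<le> exp (- u)" using u by simp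
  ultimately show "exp (- (real b / real M)) \<le> truncation_weight M b"
    unfolding w by linarith
qed

text \<open>
  Since \<open>min b M\<close> is the number of \<open>m \<in> {1..M}\<close> with \<open>m \<le> b\<close>, its conditional mean is the sum
  of the conditional probabilities of \<open>b \<ge> m\<close>, each of which is at least \<open>1 / m\<close>. This is where
  the harmonic number, and finally the logarithm in the growth of the digit sums, comes from.
\<close>

lemma nn_integral_truncation_weight_cylinder:
  assumes "M > 0" and [simp]: "length bs = n"
  shows "(\<integral>\<^sup>+x. ennreal (truncation_weight M (digit n x)) * indicator (cylinder bs 0) x \<partial>lborel)
    \<le> ennreal (1 - harm M / (2 * real M)) * emeasure lborel (cylinder bs 0)"
proof -
  let ?\<mu> = "\<lambda>m. measure lborel (cylinder bs m)"
  let ?g = "\<lambda>x. indicator (cylinder bs 0) x - (\<Sum>m=1..M. indicator (cylinder bs m) x) / (2 * real M) :: real"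
  have "(\<Sum>m=1..M. indicator (cylinder bs m) x) = real (min (digit n x) M)"
    if x: "x \<in> cylinder bs 0" for x
  proof -
    have "(\<Sum>m=1..M. indicator (cylinder bs m) x) = (\<Sum>m=1..M. if m \<in> {1..min (digit n x) M} then 1 else 0 :: real)"
      using x by (intro sum.cong) (auto simp: cylinder_def indicator_def)
    also have "\<dots> = real (card ({1..M} \<inter> {1..min (digit n x) M}))"
      by (simp only: sum.inter_restrict[symmetric] finite_atLeastAtMost) simp
    also have "{1..M} \<inter> {1..min (digit n x) M} = {1..min (digit n x) M}" by auto
    finally show ?thesis by simp
  qed
  then have g: "?g x = truncation_weight M (digit n x) * indicator (cylinder bs 0) x" for x
    by (cases "x \<in> cylinder bs 0") (auto simp: truncation_weight_def cylinder_def)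
  have fin: "emeasure lborel (cylinder bs m) < \<infinity>" for m
    by (simp add: emeasure_cylinder)
  have int: "has_bochner_integral lborel ?g (?\<mu> 0 - (\<Sum>m=1..M. ?\<mu> m) / (2 * real M))"
    by (intro has_bochner_integral_diff has_bochner_integral_divide_zero has_bochner_integral_sum
        has_bochner_integral_real_indicator fin) auto
  have nn: "0 \<le> ?g x" for x
    unfolding g using truncation_weight_bounds(1)[OF assms(1), of "digit n x"]
    by (auto split: split_indicator)
  have "(\<integral>\<^sup>+x. ennreal (truncation_weight M (digit n x)) * indicator (cylinder bs 0) x \<partial>lborel)
      = (\<integral>\<^sup>+x. ennreal (?g x) \<partial>lborel)"
    unfolding g by (intro nn_integral_cong) (auto split: split_indicator)
  also have "\<dots> = ennreal (?\<mu> 0 - (\<Sum>m=1..M. ?\<mu> m) / (2 * real M))"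
    using int nn by (subst nn_integral_eq_integral)
      (auto simp: has_bochner_integral_iff)
  also have "\<dots> \<le> ennreal ((1 - harm M / (2 * real M)) * ?\<mu> 0)"
  proof (rule ennreal_leI)
    have "harm M * ?\<mu> 0 = (\<Sum>m=1..M. ?\<mu> 0 / real m)"
      by (simp add: harm_def sum_distrib_left divide_inverse mult.commute)
    also have "\<dots> \<le> (\<Sum>m=1..M. ?\<mu> m)"
      by (intro sum_mono cylinder_measure_bounds) auto
    finally have "harm M * ?\<mu> 0 / (2 * real M) \<le> (\<Sum>m=1..M. ?\<mu> m) / (2 * real M)"
      by (rule divide_right_mono) simp
    then show "?\<mu> 0 - (\<Sum>m=1..M. ?\<mu> m) / (2 * real M) \<le> (1 - harm M / (2 * real M)) * ?\<mu> 0"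
      by (simp add: algebra_simps)
  qed
  also have "\<dots> = ennreal (1 - harm M / (2 * real M)) * emeasure lborel (cylinder bs 0)"
    unfolding emeasure_cylinder by (rule ennreal_mult'') simp
  finally show ?thesis .
qed

text \<open>
  Keeps the factor \<open>1 - harm M / (2 M)\<close> nonnegative, as is needed to take powers of it.
\<close>

lemma harm_le_self: "harm n \<le> real n"
proof -
  have "harm n \<le> (\<Sum>k=1..n. 1 :: real)"
    unfolding harm_def by (intro sum_mono) (auto simp: inverse_eq_divide)
  then show ?thesis by simp
qed

lemma nn_integral_truncation_weight_prod:
  assumes "M > 0"
  shows "(\<integral>\<^sup>+x. ennreal (\<Prod>i<n. truncation_weight M (digit i x)) * indicator unit_irrationals x \<partial>lborel)
    \<le> ennreal ((1 - harm M / (2 * real M)) ^ n)"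
proof (induction n)
  case 0
  then show ?case using emeasure_subset_unit_irrationals_le_1[of unit_irrationals] by simp
next
  case (Suc n)
  let ?w = "truncation_weight M"
  define c where "c = 1 - harm M / (2 * real M)"
  have c: "c \<ge> 0" using harm_le_self[of M] assms by (simp add: c_def field_simps)
  define f where "f bs = ennreal (\<Prod>i<n. ?w (bs ! i))" for bs
  have f: "f (digits n x) = ennreal (\<Prod>i<n. ?w (digit i x))" for x
    by (simp add: f_def digits_def)
  have w0: "0 \<le> ?w b" for b
    using truncation_weight_bounds(1)[OF assms, of b] by simp
  have "(\<integral>\<^sup>+x. ennreal (\<Prod>i<Suc n. ?w (digit i x)) * indicator unit_irrationals x \<partial>lborel)
      = (\<integral>\<^sup>+x. f (digits n x) * ennreal (?w (digit n x)) * indicator unit_irrationals x \<partial>lborel)"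
    using w0 by (simp add: f ennreal_mult prod_nonneg)
  also have "\<dots> \<le> ennreal c * (\<integral>\<^sup>+x. f (digits n x) * indicator unit_irrationals x \<partial>lborel)"
    unfolding c_def
    by (intro nn_integral_digits_le nn_integral_truncation_weight_cylinder assms)
       (simp add: truncation_weight_def)
  also have "\<dots> \<le> ennreal c * ennreal (c ^ n)"
    unfolding f using Suc by (intro mult_left_mono) (auto simp: c_def)
  also have "\<dots> = ennreal (c ^ Suc n)"
    using c by (simp add: ennreal_mult)
  finally show ?case unfolding c_def .
qed

text \<open>
  Markov's inequality for the product of the weights: on the event in question it is at least
  \<open>exp (- K / M)\<close>, whereas its integral is at most
  \<open>(1 - harm M / (2 M)) ^ n \<le> exp (- n harm M / (2 M))\<close>.
\<close>

lemma emeasure_digit_sum_le: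
  assumes "M > 0"
  shows "emeasure lborel {x \<in> unit_irrationals. (\<Sum>i<n. real (digit i x)) \<le> K}
    \<le> ennreal (exp (K / real M - real n * harm M / (2 * real M)))"
proof -
  let ?E = "{x \<in> unit_irrationals. (\<Sum>i<n. real (digit i x)) \<le> K}"
  let ?W = "\<lambda>x. \<Prod>i<n. truncation_weight M (digit i x)"
  define h where "h = harm M / (2 * real M)"
  have h: "0 \<le> 1 - h" using harm_le_self[of M] assms by (simp add: h_def field_simps)
  have w0: "0 \<le> truncation_weight M b" for b
    using truncation_weight_bounds(1)[OF assms, of b] by simp
  have pt: "1 \<le> exp (K / real M) * ?W x" if "x \<in> ?E" for x
  proof -
    have "exp (- (K / real M)) \<le> exp (\<Sum>i<n. - (real (digit i x) / real M))"
      using that assms by (simp add: sum_negf sum_divide_distrib[symmetric] divide_right_mono)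
    also have "\<dots> = (\<Prod>i<n. exp (- (real (digit i x) / real M)))"
      by (simp add: exp_sum)
    also have "\<dots> \<le> ?W x"
      by (intro prod_mono conjI truncation_weight_bounds(2) assms) auto
    finally show ?thesis by (simp add: exp_minus field_simps)
  qed
  have "emeasure lborel ?E = (\<integral>\<^sup>+x. indicator ?E x \<partial>lborel)"
    by (subst nn_integral_indicator) auto
  also have "\<dots> \<le> (\<integral>\<^sup>+x. ennreal (exp (K / real M)) * (ennreal (?W x) * indicator unit_irrationals x) \<partial>lborel)"
  proof (rule nn_integral_mono)
    fix x
    show "indicator ?E x \<le> ennreal (exp (K / real M)) * (ennreal (?W x) * indicator unit_irrationals x)"
    proof (cases "x \<in> ?E")
      case True
      then show ?thesis
        using pt[OF True] w0 by (simp add: ennreal_mult[symmetric] prod_nonneg)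
    qed simp
  qed
  also have "\<dots> = ennreal (exp (K / real M)) * (\<integral>\<^sup>+x. ennreal (?W x) * indicator unit_irrationals x \<partial>lborel)"
    unfolding truncation_weight_def by (rule nn_integral_cmult) measurable
  also have "\<dots> \<le> ennreal (exp (K / real M)) * ennreal ((1 - h) ^ n)"
    unfolding h_def by (intro mult_left_mono nn_integral_truncation_weight_prod assms) simp
  also have "\<dots> \<le> ennreal (exp (K / real M)) * ennreal (exp (- h) ^ n)"
    using h exp_ge_add_one_self[of "- h"]
    by (intro mult_left_mono ennreal_leI power_mono) auto
  also have "\<dots> = ennreal (exp (K / real M - real n * harm M / (2 * real M)))"
    by (simp add: h_def ennreal_mult[symmetric] exp_of_nat_mult[symmetric] exp_add[symmetric])
  finally show ?thesis .
qed

text \<open>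
  The truncation level is \<open>M = \<lfloor>sqrt n\<rfloor>\<close>. It is large enough for \<open>harm M\<close> to be at least
  \<open>ln n / 2\<close>, and small enough for the probability in \<open>emeasure_digit_sum_le\<close> to be at most
  \<open>exp (- sqrt n ln n / 8)\<close>, which is summable. Hence Borel--Cantelli applies without passing to
  a subsequence.
\<close>

lemma AE_digit_sum_ge:
  "AE x in lborel. x \<in> unit_irrationals \<longrightarrow>
    (\<forall>\<^sub>F n in sequentially. real n * ln (real n) / 8 \<le> (\<Sum>i<n. real (digit i x)))"
proof -
  define K where "K n = real n * ln (real n) / 8" for n
  define A where "A n = {x \<in> unit_irrationals. (\<Sum>i<n. real (digit i x)) \<le> K n}" for n
  have [measurable]: "A n \<in> sets borel" for n
    unfolding A_def by measurable
  have fin: "emeasure lborel (A n) < \<infinity>" for n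
    using emeasure_subset_unit_irrationals_le_1[of "A n"]
    by (auto simp: A_def less_top[symmetric] top_unique)
  \<comment> \<open>From \<open>n = 256\<close> on, \<open>sqrt n / 8 \<ge> 2\<close>, which yields the exponent \<open>- 2\<close>.\<close>
  have bound: "measure lborel (A n) \<le> real n powr - 2" if n: "n \<ge> 256" for n
  proof -
    have s: "sqrt (real n) \<ge> 16" using n real_sqrt_le_mono[of 256 "real n"] by simp
    have l: "ln (real n) \<ge> 0" using n by simp
    define M where "M = nat \<lfloor>sqrt (real n)\<rfloor>"
    have M: "real M \<le> sqrt (real n)" "sqrt (real n) \<le> real M + 1" "M > 0"
      unfolding M_def using s by linarith+
    have "ln (real n) / 2 = ln (sqrt (real n))" using n by (simp add: ln_sqrt)
    also have "\<dots> \<le> ln (real M + 1)" using M n by (subst ln_le_cancel_iff) auto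
    also have "\<dots> \<le> harm M" by (rule ln_le_harm)
    finally have h: "ln (real n) / 2 \<le> harm M" .
    have "2 * ln (real n) \<le> sqrt (real n) / 8 * ln (real n)"
      using s l by (intro mult_right_mono) auto
    also have "\<dots> \<le> (real n / real M) / 8 * ln (real n)"
    proof -
      have "sqrt (real n) * real M \<le> sqrt (real n) * sqrt (real n)"
        using M by (intro mult_left_mono) auto
      then have "sqrt (real n) \<le> real n / real M" using M by (simp add: field_simps)
      then show ?thesis using l by (intro mult_right_mono) auto
    qed
    also have "\<dots> = real n / (2 * real M) * (ln (real n) / 2) - K n / real M"
      by (simp add: K_def field_simps)
    also have "\<dots> \<le> real n / (2 * real M) * harm M - K n / real M"
      using h by (intro diff_right_mono mult_left_mono) auto
    finally have e: "K n / real M - real n * harm M / (2 * real M) \<le> - 2 * ln (real n)"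
      by simp
    have "emeasure lborel (A n) \<le> ennreal (exp (K n / real M - real n * harm M / (2 * real M)))"
      unfolding A_def by (rule emeasure_digit_sum_le[OF M(3)])
    also have "\<dots> \<le> ennreal (exp (- 2 * ln (real n)))"
      using e by (intro ennreal_leI) simp
    also have "exp (- 2 * ln (real n)) = real n powr - 2"
      using n by (simp add: powr_def)
    finally show ?thesis
      using fin[of n] by (simp add: emeasure_eq_ennreal_measure ennreal_le_iff less_top)
  qed
  have "summable (\<lambda>n. measure lborel (A n))"
  proof (rule summable_comparison_test_ev)
    show "summable (\<lambda>n. real n powr - 2)"
      by (simp add: summable_real_powr_iff)
    show "\<forall>\<^sub>F n in sequentially. norm (measure lborel (A n)) \<le> real n powr - 2"
      using bound by (intro eventually_sequentiallyI[of 256]) auto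
  qed
  then have "AE x in lborel. \<forall>\<^sub>F n in sequentially. x \<in> space lborel - A n"
    by (intro borel_cantelli_AE1 fin) auto
  then show ?thesis
  proof (rule AE_mp, intro AE_I2 impI)
    fix x assume "\<forall>\<^sub>F n in sequentially. x \<in> space lborel - A n" and x: "x \<in> unit_irrationals"
    then show "\<forall>\<^sub>F n in sequentially. real n * ln (real n) / 8 \<le> (\<Sum>i<n. real (digit i x))"
      by (elim eventually_mono) (auto simp: A_def K_def not_le)
  qed
qed

section \<open>From digit bounds to the upper limit\<close>

text \<open>
  The quotient \<open>b n / S n\<close> is at most a constant times \<open>ln n powr \<epsilon>\<close>, because one full power of
  \<open>ln n\<close> cancels. Its logarithm is therefore at most \<open>\<epsilon> ln (ln n)\<close> plus a constant, and
  the second \<open>\<epsilon>\<close> in the bound absorbs this constant. The lower bound \<open>n \<le> S n\<close> allows to pass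
  from \<open>ln (ln n)\<close> to \<open>ln (ln (S n))\<close>.
\<close>

lemma limsup_log_ratio_le:
  fixes b S :: "nat \<Rightarrow> real" and \<epsilon> :: real
  assumes "\<epsilon> > 0"
    and b: "\<And>n. b n > 0" "\<forall>\<^sub>F n in sequentially. b n \<le> real n * ln (real n + 1) powr (1 + \<epsilon>)"
    and S: "\<And>n. S n \<ge> real n" "\<forall>\<^sub>F n in sequentially. real n * ln (real n) / 8 \<le> S n"
  shows "limsup (\<lambda>n. ereal (ln (b n / S n) / ln (ln (S n)))) \<le> ereal (2 * \<epsilon>)"
proof (rule Limsup_bounded)
  let ?c = "ln 8 + (1 + \<epsilon>) * ln 2 :: real"
  have "filterlim (\<lambda>n. ln (ln (real n))) at_top sequentially"
    by (intro filterlim_compose[OF ln_at_top] filterlim_real_sequentially)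
  then have "\<forall>\<^sub>F n in sequentially. ?c / \<epsilon> \<le> ln (ln (real n))"
    by (simp add: filterlim_at_top)
  then show "\<forall>\<^sub>F n in sequentially. ereal (ln (b n / S n) / ln (ln (S n))) \<le> ereal (2 * \<epsilon>)"
    using b(2) S(2) eventually_ge_at_top[of 2]
  proof eventually_elim
    case (elim n)
    let ?L = "ln (ln (real n))"
    have c: "0 < ?c / \<epsilon>" using assms(1) by (intro divide_pos_pos add_pos_pos mult_pos_pos) auto
    have l: "0 < ln (real n)" using elim by simp
    have S0: "0 < S n" using S(1)[of n] elim by simp
    have LS: "?L \<le> ln (ln (S n))"
      using S(1)[of n] elim l S0 by simp
    have LS0: "0 < ln (ln (S n))" using c elim LS by linarith
    have sq: "real n + 1 \<le> real n * real n"
    proof -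
      have "2 * real n \<le> real n * real n" using elim by (intro mult_right_mono) auto
      then show ?thesis using elim by linarith
    qed
    have "ln (real n + 1) \<le> ln (real n * real n)"
      using sq elim by (subst ln_le_cancel_iff) auto
    also have "\<dots> = 2 * ln (real n)" using elim by (simp add: ln_mult)
    finally have "ln (real n + 1) powr (1 + \<epsilon>) \<le> (2 * ln (real n)) powr (1 + \<epsilon>)"
      using assms(1) by (intro powr_mono2) auto
    also have "\<dots> = 2 powr (1 + \<epsilon>) * ln (real n) powr \<epsilon> * ln (real n)"
      using l by (simp add: powr_mult powr_add)
    finally have "b n \<le> real n * (2 powr (1 + \<epsilon>) * ln (real n) powr \<epsilon> * ln (real n))"
      using elim(2) by (meson mult_left_mono of_nat_0_le_iff order_trans)
    also have "\<dots> = (8 * 2 powr (1 + \<epsilon>) * ln (real n) powr \<epsilon>) * (real n * ln (real n) / 8)"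
      by simp
    also have "\<dots> \<le> (8 * 2 powr (1 + \<epsilon>) * ln (real n) powr \<epsilon>) * S n"
      using elim(3) by (intro mult_left_mono) auto
    finally have "b n / S n \<le> 8 * 2 powr (1 + \<epsilon>) * ln (real n) powr \<epsilon>"
      using S0 by (simp add: field_simps)
    then have "ln (b n / S n) \<le> ln (8 * 2 powr (1 + \<epsilon>) * ln (real n) powr \<epsilon>)"
      using b(1)[of n] S0 l by (subst ln_le_cancel_iff) auto
    also have "\<dots> = ?c + \<epsilon> * ?L"
      using l by (simp add: ln_mult ln_powr)
    also have "\<dots> \<le> \<epsilon> * ?L + \<epsilon> * ?L"
      using elim(1) assms(1) by (intro add_right_mono) (simp add: field_simps)
    also have "\<dots> \<le> 2 * \<epsilon> * ln (ln (S n))"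
      using LS assms(1) by simp
    finally show ?case using LS0 by (simp add: field_simps)
  qed
qed

theorem lemma7p1:
  shows "AE x in lebesgue_on {0..1::real}.
    \<exists>a :: nat \<Rightarrow> nat. has_cf_expansion x a \<and>
      limsup (\<lambda>n. ereal (ln (real (a (n + 1)) / (\<Sum>i=1..n. real (a i)))
                           / ln (ln (\<Sum>i=1..n. real (a i))))) \<le> 0"
    (is "AE x in _. ?P x")
proof -
  \<comment> \<open>The exponents \<open>1 + \<epsilon>\<close> are restricted to a sequence to keep the exceptional set null.\<close>
  have digit_le: "AE x in lborel. \<forall>k. x \<in> unit_irrationals \<longrightarrow>
      (\<forall>\<^sub>F n in sequentially. real (digit n x) \<le> real n * ln (real n + 1) powr (1 + 1 / real (Suc k)))"
    unfolding AE_all_countable by (intro allI AE_digit_le) simp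
  have "countable (\<rat> :: real set)" by (rule countable_rat)
  then have irr: "AE x in lborel. x \<notin> (\<rat> :: real set)"
    by (intro AE_not_in countable_imp_null_set_lborel)
  have "AE x in lborel. x \<in> {0..1} \<longrightarrow> ?P x"
    using digit_le AE_digit_sum_ge irr
  proof eventually_elim
    case (elim x)
    show ?case
    proof
      assume "x \<in> {0..1}"
      with elim(3) have x: "x \<in> unit_irrationals"
        by (auto simp: unit_irrationals_def le_less)
      define a where "a i = digit (i - 1) x" for i
      have sum: "(\<Sum>i=1..n. real (a i)) = (\<Sum>i<n. real (digit i x))" for n
        by (simp add: a_def sum.atLeast1_atMost_eq)
      have sum_ge: "real n \<le> (\<Sum>i<n. real (digit i x))" for n
        using sum_mono[of "{..<n}" "\<lambda>_. 1" "\<lambda>i. real (digit i x)"] digit_pos[OF x] by simp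
      let ?l = "limsup (\<lambda>n. ereal (ln (real (a (n + 1)) / (\<Sum>i=1..n. real (a i)))
                           / ln (ln (\<Sum>i=1..n. real (a i)))))"
      have le: "?l \<le> ereal (2 * (1 / real (Suc k)))" for k
        unfolding sum using elim(1,2) x digit_pos[OF x] sum_ge
        by (intro limsup_log_ratio_le) (auto simp: a_def Suc_le_eq)
      have "(\<lambda>k. ereal (2 * (1 / real (Suc k)))) \<longlonglongrightarrow> ereal (2 * 0)"
        by (intro tendsto_intros LIMSEQ_Suc[OF lim_1_over_n])
      then have "?l \<le> ereal (2 * 0)"
        by (rule LIMSEQ_le_const) (use le in auto)
      then have "?l \<le> 0"
        by (simp only: mult_zero_right zero_ereal_def)
      moreover have "has_cf_expansion x a"
        using has_cf_expansion_digits[OF x] by (simp add: a_def[abs_def])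
      ultimately show "?P x" by blast
    qed
  qed
  then have "AE x in lebesgue. x \<in> {0..1} \<longrightarrow> ?P x"
    by (rule AE_completion)
  then show ?thesis
    by (subst AE_restrict_space_iff) auto
qed

end
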